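(* The teamwork synthesis problem is decidable. That is, there is an algorithm for the following problem: given a (finite) Mealy machine $M$ with interface $\langle Y,O\rangle$ and a partition of the interface into $\{\langle Y_k,O_k\rangle\}_{k\in K}$, $K=\{1,\dots,n\}$, with $Y=\bigcup_{k\in K}Y_k$ and $O=\bigcup_{k\in K}O_k$, find transition systems $\{T_k\}_{k\in K}$, $T_k$ having interface $\langle Y_k,O_k\rangle$, such that $T=T_1\|\cdots\|T_n$ satisfies $\mathcal L_M\cong\mathcal L_T$.
   Context: **Mealy machines.** A Mealy machine is $M=\langle Q,Y,O,\iota,\delta\rangle$ with state set $Q$, input alphabet $Y$, set of output variables $O$, deterministic transition (and output) relation $\delta\subseteq Q\times(Y\times 2^{O})\times Q$, and initial labelled transition $\iota=((c_0,O_0),q_0)$ with $q_0\in Q$ the initial state, $c_0\in Y$, $O_0\in 2^{O}$. A run is an infinite sequence $(c_0,O_0)q_0(c_1,O_1)q_1\cdots$ with $(q_k,(c_{k+1},O_{k+1}),q_{k+1})\in\delta$ for all $k\ge0$; its word is $(c_0,O_0)(c_1,O_1)\cdots$; $\mathcal L_M\subseteq (Y\times 2^{O})^\omega$ is the set of words of runs. **Transition systems.** Fix the global set of channels $C=Y$. A transition system (TS) is a tuple $T=\langle S,s_0,Y_T,O_T,\mathrm{ls},L,\Delta\rangle$: states $S$, initial state $s_0$; $Y_T\subseteq C$ the channels on which $T$ can initiate; $O_T$ an output alphabet; $\langle Y_T,O_T\rangle$ the interface; $\mathrm{ls}:S\to 2^{C}$; $L:S\to 2^{Y_T}\times 2^{O_T}$,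 $L(s)=(L^c(s),L^o(s))$; $\Delta\subseteq S\times C\times S$, with $\Delta(s,c)=\{s'\mid (s,c,s')\in\Delta\}$; such that (i) $\Delta(s,c)\ne\emptyset$ iff $c\in \mathrm{ls}(s)$; (ii) if $c\in Y_T$ and $s'\in\Delta(s,c)$ then $c\in L^c(s')$. $T$ is communication-closed if $\Delta\subseteq S\times Y_T\times S$. A run of a communication-closed TS is an infinite sequence $s_0c_0s_1c_1\cdots$ with $(s_i,c_i,s_{i+1})\in\Delta$; the language $\mathcal L_T$ is the set of sequences $L(s_0)L(s_1)L(s_2)\cdots$ induced by runs. **Composition.** $T_1\|T_2$ has states $S_1\times S_2$, initial state $(s_1^0,s_2^0)$, interface $\langle Y_1\cup Y_2,O_1\cup O_2\rangle$, $\mathrm{ls}((s_1,s_2))=\mathrm{ls}_1(s_1)\cup\mathrm{ls}_2(s_2)$, $L((s_1,s_2))=(L_1^c(s_1)\cup L_2^c(s_2),L_1^o(s_1)\cup L_2^o(s_2))$, and $((s_1,s_2),c,(s_1',s_2'))\in\Delta$ iff one of: (a) $c\in Y_1$, $(s_1,c,s_1')\in\Delta_1$ and either [$c\in\mathrm{ls}_2(s_2)$ and $(s_2,c,s_2')\in\Delta_2$] or [$c\notin\mathrm{ls}_2(s_2)$ and $s_2'=s_2$]; (b) the same with roles of 1 and 2 exchanged; (c) $c\notin Y_1\cup Y_2$ and either both $c\in \mathrm{ls}_i(s_i)$ and $(s_i,c,s_i')\in\Delta_i$ for $i=1,2$, or $c\in\mathrm{ls}_1(s_1)\setminus\mathrm{ls}_2(s_2)$,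 $(s_1,c,s_1')\in\Delta_1$, $s_2'=s_2$, or $c\in\mathrm{ls}_2(s_2)\setminus\mathrm{ls}_1(s_1)$, $(s_2,c,s_2')\in\Delta_2$, $s_1'=s_1$. Compositions of several TSs are obtained by iterating $\|$. The sets $Y_k$ are pairwise disjoint, and so are the $O_k$. **Language isomorphism.** For alphabets $\Sigma,\Pi$ and a bijection $I:\Sigma\to\Pi$, extended letterwise to sequences and to sets of sequences, languages $\mathcal L$ over $\Sigma$ and $\mathcal L'$ over $\Pi$ are isomorphic, $\mathcal L\cong\mathcal L'$, if $I(\mathcal L)=\mathcal L'$ for some such $I$. Here the intended alphabets are $Y\times 2^{O}$ for $M$ and $\{\{c\}\mid c\in Y\}\times 2^{O}$ for $T$. *)

theory Defs
  imports Main "HOL-Library.Nat_Bijection"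
begin

section \<open>Mealy machines\<close>

type_synonym ('c, 'o) letter = "'c \<times> 'o set"

record ('q, 'c, 'o) mealy =
  m_states :: "'q set"
  m_inputs :: "'c set"
  m_outputs :: "'o set"
  m_init :: "('c, 'o) letter \<times> 'q"
  m_trans :: "('q \<times> ('c, 'o) letter \<times> 'q) set"

text \<open>Determinism is that of Mealy machines: state and input determine both the output and
  the successor, if there is one (the relation may be partial).\<close>

definition is_mealy :: "('q, 'c, 'o) mealy \<Rightarrow> bool" where
  "is_mealy M \<longleftrightarrow>
     m_init M \<in> (m_inputs M \<times> Pow (m_outputs M)) \<times> m_states M \<and>
     m_trans M \<subseteq> m_states M \<times> (m_inputs M \<times> Pow (m_outputs M)) \<times> m_states M \<and>
     (\<forall>q c A A' q' q''. (q, (c, A), q') \<in> m_trans M \<longrightarrow> (q, (c, A'), q'') \<in> m_trans M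
        \<longrightarrow> A = A' \<and> q' = q'')"

definition finite_mealy :: "('q, 'c, 'o) mealy \<Rightarrow> bool" where
  "finite_mealy M \<longleftrightarrow> finite (m_states M) \<and> finite (m_inputs M) \<and> finite (m_outputs M)"

text \<open>\<open>w k\<close> and \<open>q k\<close> are the \<open>k\<close>-th letter and state of the run
  \<open>w 0, q 0, w 1, q 1, \<dots>\<close>.\<close>

definition mealy_run :: "('q, 'c, 'o) mealy \<Rightarrow> (nat \<Rightarrow> ('c, 'o) letter) \<Rightarrow> (nat \<Rightarrow> 'q) \<Rightarrow> bool" where
  "mealy_run M w q \<longleftrightarrow> (w 0, q 0) = m_init M \<and> (\<forall>k. (q k, w (Suc k), q (Suc k)) \<in> m_trans M)"

definition mealy_lang :: "('q, 'c, 'o) mealy \<Rightarrow> (nat \<Rightarrow> ('c, 'o) letter) set" where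
  "mealy_lang M = {w. \<exists>q. mealy_run M w q}"

section \<open>Transition systems\<close>

record ('s, 'c, 'o) ts =
  t_states :: "'s set"
  t_init :: 's
  t_chans :: "'c set"
  t_outs :: "'o set"
  t_ls :: "'s \<Rightarrow> 'c set"
  t_lab :: "'s \<Rightarrow> 'c set \<times> 'o set"
  t_trans :: "('s \<times> 'c \<times> 's) set"

text \<open>The first argument is the global set of channels. State spaces may be infinite here.\<close>

definition is_ts :: "'c set \<Rightarrow> ('s, 'c, 'o) ts \<Rightarrow> bool" where
  "is_ts C T \<longleftrightarrow>
     t_init T \<in> t_states T \<and> t_chans T \<subseteq> C \<and>
     (\<forall>s \<in> t_states T. t_ls T s \<subseteq> C) \<and>
     (\<forall>s \<in> t_states T. t_lab T s \<in> Pow (t_chans T) \<times> Pow (t_outs T)) \<and>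
     t_trans T \<subseteq> t_states T \<times> C \<times> t_states T \<and>
     (\<forall>s \<in> t_states T. \<forall>c \<in> C. (\<exists>s'. (s, c, s') \<in> t_trans T) \<longleftrightarrow> c \<in> t_ls T s) \<and>
     (\<forall>s c s'. c \<in> t_chans T \<longrightarrow> (s, c, s') \<in> t_trans T \<longrightarrow> c \<in> fst (t_lab T s'))"

definition finite_ts :: "('s, 'c, 'o) ts \<Rightarrow> bool" where
  "finite_ts T \<longleftrightarrow> finite (t_states T) \<and> finite (t_chans T) \<and> finite (t_outs T)"

definition comm_closed :: "('s, 'c, 'o) ts \<Rightarrow> bool" where
  "comm_closed T \<longleftrightarrow> t_trans T \<subseteq> t_states T \<times> t_chans T \<times> t_states T"

definition ts_run :: "('s, 'c, 'o) ts \<Rightarrow> (nat \<Rightarrow> 's) \<Rightarrow> (nat \<Rightarrow> 'c) \<Rightarrow> bool" where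
  "ts_run T s c \<longleftrightarrow> s 0 = t_init T \<and> (\<forall>i. (s i, c i, s (Suc i)) \<in> t_trans T)"

text \<open>Meant for communication-closed systems only.\<close>

definition ts_lang :: "('s, 'c, 'o) ts \<Rightarrow> (nat \<Rightarrow> 'c set \<times> 'o set) set" where
  "ts_lang T = {w. \<exists>s c. ts_run T s c \<and> w = (\<lambda>i. t_lab T (s i))}"

section \<open>Composition\<close>

definition comp_trans :: "('s, 'c, 'o) ts \<Rightarrow> ('t, 'c, 'o) ts \<Rightarrow> 's \<times> 't \<Rightarrow> 'c \<Rightarrow> 's \<times> 't \<Rightarrow> bool" where
  "comp_trans T1 T2 = (\<lambda>(s1, s2) c (s1', s2').
     (c \<in> t_chans T1 \<and> (s1, c, s1') \<in> t_trans T1 \<and>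
        (c \<in> t_ls T2 s2 \<and> (s2, c, s2') \<in> t_trans T2 \<or> c \<notin> t_ls T2 s2 \<and> s2' = s2)) \<or>
     (c \<in> t_chans T2 \<and> (s2, c, s2') \<in> t_trans T2 \<and>
        (c \<in> t_ls T1 s1 \<and> (s1, c, s1') \<in> t_trans T1 \<or> c \<notin> t_ls T1 s1 \<and> s1' = s1)) \<or>
     (c \<notin> t_chans T1 \<union> t_chans T2 \<and>
        (c \<in> t_ls T1 s1 \<and> (s1, c, s1') \<in> t_trans T1 \<and> c \<in> t_ls T2 s2 \<and> (s2, c, s2') \<in> t_trans T2 \<or>
         c \<in> t_ls T1 s1 - t_ls T2 s2 \<and> (s1, c, s1') \<in> t_trans T1 \<and> s2' = s2 \<or>
         c \<in> t_ls T2 s2 - t_ls T1 s1 \<and> (s2, c, s2') \<in> t_trans T2 \<and> s1' = s1)))"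

text \<open>The composite may violate the condition that every channel listened to is enabled (a
  component can listen to a channel whose owner is not ready to use it), so \<open>is_ts\<close> is not
  expected of it.\<close>

definition ts_comp :: "('s, 'c, 'o) ts \<Rightarrow> ('t, 'c, 'o) ts \<Rightarrow> ('s \<times> 't, 'c, 'o) ts" where
  "ts_comp T1 T2 = \<lparr>
     t_states = t_states T1 \<times> t_states T2,
     t_init = (t_init T1, t_init T2),
     t_chans = t_chans T1 \<union> t_chans T2,
     t_outs = t_outs T1 \<union> t_outs T2,
     t_ls = (\<lambda>(s1, s2). t_ls T1 s1 \<union> t_ls T2 s2),
     t_lab = (\<lambda>(s1, s2). (fst (t_lab T1 s1) \<union> fst (t_lab T2 s2), snd (t_lab T1 s1) \<union> snd (t_lab T2 s2))),
     t_trans = {(s, c, s'). s \<in> t_states T1 \<times> t_states T2 \<and> s' \<in> t_states T1 \<times> t_states T2 \<and>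
                  comp_trans T1 T2 s c s'} \<rparr>"

text \<open>Iterating the composition changes the type of states at each step. To iterate it a
  variable number of times, states are taken from \<open>nat\<close> and the pairs of a product are renamed
  by the bijection \<open>prod_encode\<close>.\<close>

definition pair_rename :: "(nat \<times> nat, 'c, 'o) ts \<Rightarrow> (nat, 'c, 'o) ts" where
  "pair_rename T = \<lparr>
     t_states = prod_encode ` t_states T,
     t_init = prod_encode (t_init T),
     t_chans = t_chans T,
     t_outs = t_outs T,
     t_ls = t_ls T \<circ> prod_decode,
     t_lab = t_lab T \<circ> prod_decode,
     t_trans = {(prod_encode s, c, prod_encode s') | s c s'. (s, c, s') \<in> t_trans T} \<rparr>"

text \<open>\<open>((T\<^sub>1 \<parallel> T\<^sub>2) \<parallel> \<dots>) \<parallel> T\<^sub>n\<close>, for nonempty lists.\<close>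

definition ts_comp_list :: "(nat, 'c, 'o) ts list \<Rightarrow> (nat, 'c, 'o) ts" where
  "ts_comp_list Ts = foldl (\<lambda>T T'. pair_rename (ts_comp T T')) (hd Ts) (tl Ts)"

section \<open>Isomorphism of languages\<close>

definition lang_iso ::
  "'a set \<Rightarrow> 'b set \<Rightarrow> (nat \<Rightarrow> 'a) set \<Rightarrow> (nat \<Rightarrow> 'b) set \<Rightarrow> bool" where
  "lang_iso \<Sigma> \<Pi> L L' \<longleftrightarrow> (\<exists>I. bij_betw I \<Sigma> \<Pi> \<and> (\<lambda>w. I \<circ> w) ` L = L')"

section \<open>The teamwork synthesis problem\<close>

text \<open>An instance is a machine together with the list of the interfaces
  \<open>(Y\<^sub>1, O\<^sub>1), \<dots>, (Y\<^sub>n, O\<^sub>n)\<close>. For the purpose of computation, the states, channels and outputs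
  of the machine are named by natural numbers. Single blocks may be empty, but \<open>n \<ge> 1\<close>
  follows as the set of inputs is nonempty.\<close>

type_synonym teamwork_problem = "(nat, nat, nat) mealy \<times> (nat set \<times> nat set) list"

definition teamwork_instance :: "teamwork_problem \<Rightarrow> bool" where
  "teamwork_instance = (\<lambda>(M, P).
     is_mealy M \<and> finite_mealy M \<and>
     (\<Union>k<length P. fst (P ! k)) = m_inputs M \<and>
     (\<Union>k<length P. snd (P ! k)) = m_outputs M \<and>
     (\<forall>j<length P. \<forall>k<length P. j \<noteq> k \<longrightarrow>
        fst (P ! j) \<inter> fst (P ! k) = {} \<and> snd (P ! j) \<inter> snd (P ! k) = {}))"

definition teamwork_solution :: "teamwork_problem \<Rightarrow> (nat, nat, nat) ts list \<Rightarrow> bool" where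
  "teamwork_solution = (\<lambda>(M, P) Ts.
     length Ts = length P \<and>
     (\<forall>k<length P. is_ts (m_inputs M) (Ts ! k) \<and>
        t_chans (Ts ! k) = fst (P ! k) \<and> t_outs (Ts ! k) = snd (P ! k)) \<and>
     comm_closed (ts_comp_list Ts) \<and>
     lang_iso (m_inputs M \<times> Pow (m_outputs M)) ((\<lambda>c. {c}) ` m_inputs M \<times> Pow (m_outputs M))
       (mealy_lang M) (ts_lang (ts_comp_list Ts)))"

section \<open>Computable functions\<close>

text \<open>Kleene's partial recursive functions: programs and their (big-step) semantics.\<close>

datatype recf =
    Zero | Succ | Proj nat | Comp recf "recf list" | PrimRec recf recf | Mu recf

inductive rec_eval :: "recf \<Rightarrow> nat list \<Rightarrow> nat \<Rightarrow> bool" where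
  Zero: "rec_eval Zero xs 0"
| Succ: "rec_eval Succ [x] (Suc x)"
| Proj: "i < length xs \<Longrightarrow> rec_eval (Proj i) xs (xs ! i)"
| Comp: "list_all2 (\<lambda>g y. rec_eval g xs y) gs ys \<Longrightarrow> rec_eval f ys z \<Longrightarrow> rec_eval (Comp f gs) xs z"
| PrimRec_0: "rec_eval f xs y \<Longrightarrow> rec_eval (PrimRec f g) (0 # xs) y"
| PrimRec_Suc: "rec_eval (PrimRec f g) (n # xs) r \<Longrightarrow> rec_eval g (n # r # xs) y
    \<Longrightarrow> rec_eval (PrimRec f g) (Suc n # xs) y"
| Mu: "rec_eval f (n # xs) 0 \<Longrightarrow> (\<And>m. m < n \<Longrightarrow> \<exists>y. rec_eval f (m # xs) (Suc y))
    \<Longrightarrow> rec_eval (Mu f) xs n"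
  monos list_all2_mono

inductive_cases rec_evalE:
  "rec_eval Zero xs z" "rec_eval Succ xs z" "rec_eval (Proj i) xs z" "rec_eval (Comp f gs) xs z"
  "rec_eval (PrimRec f g) xs z" "rec_eval (Mu f) xs z"

lemma rec_eval_deterministic: "rec_eval f xs y \<Longrightarrow> rec_eval f xs z \<Longrightarrow> y = z"
proof (induction arbitrary: z rule: rec_eval.induct)
  case (Comp xs gs ys f w)
  from Comp.prems obtain ys' where
    ys': "list_all2 (\<lambda>g y. rec_eval g xs y) gs ys'" "rec_eval f ys' z"
    by (auto elim: rec_evalE)
  have "ys = ys'"
    using Comp.IH(1) ys'(1) by (auto simp: list_all2_conv_all_nth intro!: nth_equalityI)
  with Comp.IH(2) ys'(2) show ?case by blast
next
  case (PrimRec_Suc f g n xs r y)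
  from PrimRec_Suc.prems obtain r' where "rec_eval (PrimRec f g) (n # xs) r'" "rec_eval g (n # r' # xs) z"
    by (auto elim: rec_evalE)
  with PrimRec_Suc.IH show ?case by blast
next
  case (Mu f n xs)
  from Mu.prems have z: "rec_eval f (z # xs) 0" "\<And>m. m < z \<Longrightarrow> \<exists>y. rec_eval f (m # xs) (Suc y)"
    by (auto elim: rec_evalE)
  have "\<not> n < z"
  proof
    assume "n < z"
    then obtain y where "rec_eval f (n # xs) (Suc y)" using z(2) by blast
    with Mu.IH(1) show False by blast
  qed
  moreover have "\<not> z < n"
  proof
    assume "z < n"
    with Mu.IH(2) obtain y where "\<forall>x. rec_eval f (z # xs) x \<longrightarrow> Suc y = x" by blast
    with z(1) show False by blast
  qed
  ultimately show ?case by (metis nat_neq_iff)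
next
  case (PrimRec_0 f xs y g)
  from PrimRec_0.prems have "rec_eval f xs z" by (cases rule: rec_eval.cases) auto
  with PrimRec_0.IH show ?case by blast
next
  case Zero
  then show ?case by (cases rule: rec_eval.cases) auto
next
  case Succ
  then show ?case by (cases rule: rec_eval.cases) auto
next
  case Proj
  from Proj.prems show ?case by (cases rule: rec_eval.cases) auto
qed

definition computable :: "(nat \<Rightarrow> nat) \<Rightarrow> bool" where
  "computable f \<longleftrightarrow> (\<exists>r. \<forall>x. rec_eval r [x] (f x))"

section \<open>Encoding of instances and solutions\<close>

definition enc_letter :: "(nat, nat) letter \<Rightarrow> nat" where
  "enc_letter = (\<lambda>(c, A). prod_encode (c, set_encode A))"

definition enc_mtrans :: "nat \<times> (nat, nat) letter \<times> nat \<Rightarrow> nat" where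
  "enc_mtrans = (\<lambda>(q, l, q'). prod_encode (q, prod_encode (enc_letter l, q')))"

definition enc_mealy :: "(nat, nat, nat) mealy \<Rightarrow> nat" where
  "enc_mealy M = list_encode
     [set_encode (m_states M), set_encode (m_inputs M), set_encode (m_outputs M),
      prod_encode (enc_letter (fst (m_init M)), snd (m_init M)),
      set_encode (enc_mtrans ` m_trans M)]"

definition enc_problem :: "teamwork_problem \<Rightarrow> nat" where
  "enc_problem = (\<lambda>(M, P). prod_encode (enc_mealy M,
     list_encode (map (\<lambda>(Yk, Ok). prod_encode (set_encode Yk, set_encode Ok)) P)))"

text \<open>The two functions on states are encoded as their graphs on the set of states.\<close>

definition enc_ts :: "(nat, nat, nat) ts \<Rightarrow> nat" where
  "enc_ts T = list_encode
     [set_encode (t_states T), t_init T, set_encode (t_chans T), set_encode (t_outs T),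
      set_encode ((\<lambda>s. prod_encode (s, set_encode (t_ls T s))) ` t_states T),
      set_encode ((\<lambda>s. prod_encode (s, prod_encode
         (set_encode (fst (t_lab T s)), set_encode (snd (t_lab T s))))) ` t_states T),
      set_encode ((\<lambda>(s, c, s'). prod_encode (s, prod_encode (c, s'))) ` t_trans T)]"

definition enc_ts_list :: "(nat, nat, nat) ts list \<Rightarrow> nat" where
  "enc_ts_list Ts = list_encode (map enc_ts Ts)"

text \<open>The encodings lose no information.\<close>

lemma set_encode_image_eq:
  assumes "finite A" "finite B" "inj_on f (A \<union> B)" "set_encode (f ` A) = set_encode (f ` B)"
  shows "A = B"
proof -
  have "f ` A = f ` B"
    using assms by (simp add: set_encode_eq)
  then show ?thesis
    using assms(3) by (metis inj_on_image_eq_iff sup_ge1 sup_ge2)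
qed

lemma finite_mealy_trans:
  assumes "is_mealy M" "finite_mealy M"
  shows "finite (m_trans M)"
    and "\<And>q c A q'. (q, (c, A), q') \<in> m_trans M \<Longrightarrow> finite A"
proof -
  have *: "m_trans M \<subseteq> m_states M \<times> (m_inputs M \<times> Pow (m_outputs M)) \<times> m_states M"
    using assms(1) by (simp add: is_mealy_def)
  show "finite (m_trans M)"
    by (rule finite_subset[OF *]) (use assms(2) in \<open>auto simp: finite_mealy_def\<close>)
  show "finite A" if "(q, (c, A), q') \<in> m_trans M" for q c A q'
    using that * assms(2) by (auto simp: finite_mealy_def dest: finite_subset)
qed

lemma enc_mealy_inj:
  assumes M: "is_mealy M" "finite_mealy M" and N: "is_mealy N" "finite_mealy N"
    and eq: "enc_mealy M = enc_mealy N"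
  shows "M = N"
proof -
  have inj: "inj_on enc_mtrans (m_trans M \<union> m_trans N)"
    using finite_mealy_trans(2)[OF M] finite_mealy_trans(2)[OF N]
    by (auto simp: inj_on_def enc_mtrans_def enc_letter_def set_encode_eq)
  have t: "m_trans M = m_trans N"
    using eq finite_mealy_trans(1)[OF M] finite_mealy_trans(1)[OF N] inj
    by (intro set_encode_image_eq[of _ _ enc_mtrans]) (auto simp: enc_mealy_def)
  obtain c A q where iM: "m_init M = ((c, A), q)" by (metis prod.exhaust)
  obtain d B r where iN: "m_init N = ((d, B), r)" by (metis prod.exhaust)
  have "finite A" "finite B"
    using M N iM iN by (auto simp: is_mealy_def finite_mealy_def dest: finite_subset)
  then have "m_init M = m_init N"
    using eq by (simp add: enc_mealy_def enc_letter_def iM iN set_encode_eq)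
  then show ?thesis
    using eq t M N by (simp add: enc_mealy_def finite_mealy_def set_encode_eq)
qed

lemma enc_problem_inj:
  assumes "teamwork_instance P" "teamwork_instance P'" "enc_problem P = enc_problem P'"
  shows "P = P'"
proof -
  obtain M B where P: "P = (M, B)" by fastforce
  obtain M' B' where P': "P' = (M', B')" by fastforce
  have fin: "finite (fst b) \<and> finite (snd b)" if "teamwork_instance (N, D)" "b \<in> set D" for N D b
  proof -
    have "fst b \<subseteq> (\<Union>k<length D. fst (D ! k))" "snd b \<subseteq> (\<Union>k<length D. snd (D ! k))"
      using that(2) by (auto simp: in_set_conv_nth)
    then have "fst b \<subseteq> m_inputs N" "snd b \<subseteq> m_outputs N"
      using that(1) by (auto simp: teamwork_instance_def)
    then show ?thesis
      using that(1) by (auto simp: teamwork_instance_def finite_mealy_def dest: finite_subset)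
  qed
  have "M = M'"
    using assms by (intro enc_mealy_inj) (auto simp: P P' teamwork_instance_def enc_problem_def)
  moreover have "B = B'"
  proof (rule list.inj_map_strong)
    show "map (\<lambda>(Yk, Ok). prod_encode (set_encode Yk, set_encode Ok)) B =
          map (\<lambda>(Yk, Ok). prod_encode (set_encode Yk, set_encode Ok)) B'"
      using assms(3) by (simp add: P P' enc_problem_def list_encode_eq)
  next
    fix b b' assume b: "b \<in> set B" "b' \<in> set B'"
      and eq: "(\<lambda>(Yk, Ok). prod_encode (set_encode Yk, set_encode Ok)) b =
               (\<lambda>(Yk, Ok). prod_encode (set_encode Yk, set_encode Ok)) b'"
    show "b = b'"
      using eq fin[of M B b] fin[of M' B' b'] b assms(1,2)
      by (auto simp: P P' set_encode_eq split: prod.splits)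
  qed
  ultimately show ?thesis by (simp add: P P')
qed

lemma enc_ts_inj:
  assumes T: "is_ts C T" "finite_ts T" and T': "is_ts C T'" "finite_ts T'" and C: "finite C"
    and eq: "enc_ts T = enc_ts T'"
  shows "t_states T = t_states T'" "t_init T = t_init T'" "t_chans T = t_chans T'"
    "t_outs T = t_outs T'" "t_trans T = t_trans T'"
    "\<And>s. s \<in> t_states T \<Longrightarrow> t_ls T s = t_ls T' s \<and> t_lab T s = t_lab T' s"
proof -
  have fin: "finite (t_trans U) \<and> (\<forall>s \<in> t_states U. finite (t_ls U s) \<and>
      finite (fst (t_lab U s)) \<and> finite (snd (t_lab U s)))"
    if "is_ts C U" "finite_ts U" for U :: "(nat, nat, nat) ts"
  proof (intro conjI ballI)
    have "t_trans U \<subseteq> t_states U \<times> C \<times> t_states U"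
      using that(1) by (simp add: is_ts_def)
    then show "finite (t_trans U)"
      by (rule finite_subset) (use that(2) C in \<open>auto simp: finite_ts_def\<close>)
    fix s assume s: "s \<in> t_states U"
    show "finite (t_ls U s)"
      using that(1) s C by (auto simp: is_ts_def dest: finite_subset)
    have "t_lab U s \<in> Pow (t_chans U) \<times> Pow (t_outs U)"
      using that(1) s by (simp add: is_ts_def)
    then have "fst (t_lab U s) \<subseteq> t_chans U" "snd (t_lab U s) \<subseteq> t_outs U"
      by auto
    then show "finite (fst (t_lab U s))" "finite (snd (t_lab U s))"
      using that(2) by (auto simp: finite_ts_def dest: finite_subset)
  qed
  show st: "t_states T = t_states T'" and "t_init T = t_init T'" and "t_chans T = t_chans T'"
    and "t_outs T = t_outs T'"
    using eq T T' by (simp_all add: enc_ts_def finite_ts_def set_encode_eq)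
  show "t_trans T = t_trans T'"
    using eq fin[OF T] fin[OF T']
    by (intro set_encode_image_eq[of _ _ "\<lambda>(s, c, s'). prod_encode (s, prod_encode (c, s'))"])
       (auto simp: enc_ts_def inj_on_def)
  fix s assume s: "s \<in> t_states T"
  have finS: "finite (t_states T')" using T'(2) by (simp add: finite_ts_def)
  have "(\<lambda>s. prod_encode (s, set_encode (t_ls T s))) ` t_states T' =
        (\<lambda>s. prod_encode (s, set_encode (t_ls T' s))) ` t_states T'"
    using eq finS by (simp add: enc_ts_def set_encode_eq st)
  moreover have "prod_encode (s, set_encode (t_ls T s)) \<in>
        (\<lambda>s. prod_encode (s, set_encode (t_ls T s))) ` t_states T'"
    using s st by blast
  ultimately have 1: "set_encode (t_ls T s) = set_encode (t_ls T' s)"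
    by auto
  have "(\<lambda>s. prod_encode (s, prod_encode
           (set_encode (fst (t_lab T s)), set_encode (snd (t_lab T s))))) ` t_states T' =
        (\<lambda>s. prod_encode (s, prod_encode
           (set_encode (fst (t_lab T' s)), set_encode (snd (t_lab T' s))))) ` t_states T'"
    using eq finS by (simp add: enc_ts_def set_encode_eq st)
  moreover have "prod_encode (s, prod_encode
           (set_encode (fst (t_lab T s)), set_encode (snd (t_lab T s)))) \<in>
        (\<lambda>s. prod_encode (s, prod_encode
           (set_encode (fst (t_lab T s)), set_encode (snd (t_lab T s))))) ` t_states T'"
    using s st by blast
  ultimately have 2: "set_encode (fst (t_lab T s)) = set_encode (fst (t_lab T' s))"
    "set_encode (snd (t_lab T s)) = set_encode (snd (t_lab T' s))"
    by auto
  show "t_ls T s = t_ls T' s \<and> t_lab T s = t_lab T' s"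
    using 1 2 s st fin[OF T] fin[OF T'] by (simp add: set_encode_eq prod_eq_iff)
qed

end

(* Take the letter bijection (c, A) |-> ({c}, A). A Mealy machine is deterministic in its inputs, so
   everyone who hears all channels knows the current state of M and all outputs. Hence every
   component can be a full copy of M that listens to every channel enabled in the current state,
   only its labels being cut down to its own interface: all copies then move in lockstep, and the
   runs of the composite are those of M. So a solution always exists, and its code is a primitive
   recursive function of the code of the instance, obtained from bounded sums of powers of 2. *)
theory Submission
  imports Defs
begin

section \<open>Closure properties of the computable functions\<close>

text \<open>A Mealy machine carries letters on its transitions, a transition system carries labels
  on its states. A component state therefore also stores the letter just read, and the initial
  letter of \<open>m_init M\<close> goes into the initial state. In a composition every listener
  chooses its own successor, so equal copies could still drift apart; what prevents this is that a
  state and a channel fix the successor. Determinism is used a second time for the coding: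
  \<open>set_encode\<close> adds the powers \<open>2 ^ a\<close>, so the code of an image is a sum
  over the original set only if the map is injective there, and for the channels listened to in a
  state this says that state and input admit at most one transition. The range of the sums is the
  code of the instance itself, which bounds the initial state, the transition codes and the
  outputs.\<close>

definition computable2 :: "(nat \<Rightarrow> nat \<Rightarrow> nat) \<Rightarrow> bool" where
  "computable2 f \<longleftrightarrow> (\<exists>r. \<forall>x y. rec_eval r [x, y] (f x y))"

lemma rec_eval_Comp1: "rec_eval g xs y \<Longrightarrow> rec_eval f [y] z \<Longrightarrow> rec_eval (Comp f [g]) xs z"
  by (rule rec_eval.Comp[where ys = "[y]"]) auto

lemma rec_eval_Comp2:
  "rec_eval g xs y \<Longrightarrow> rec_eval h xs y' \<Longrightarrow> rec_eval f [y, y'] z \<Longrightarrow> rec_eval (Comp f [g, h]) xs z"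
  by (rule rec_eval.Comp[where ys = "[y, y']"]) auto

lemma rec_eval_Proj: "i < length xs \<Longrightarrow> xs ! i = y \<Longrightarrow> rec_eval (Proj i) xs y"
  using rec_eval.Proj by blast

text \<open>Lets computability be shown by rewriting a function as a \<open>rec_nat\<close> term,
  without further reference to the evaluation rules.\<close>

lemma rec_eval_PrimRec:
  assumes "rec_eval f xs a" and "\<And>i r. rec_eval g (i # r # xs) (h i r)"
  shows "rec_eval (PrimRec f g) (n # xs) (rec_nat a h n)"
  by (induction n) (auto intro: rec_eval.intros assms)

lemma rec_eval_const: "\<exists>r. \<forall>xs. rec_eval r xs c"
proof (induction c)
  case 0
  show ?case by (blast intro: rec_eval.Zero)
next
  case (Suc c)
  then show ?case by (blast intro: rec_eval_Comp1 rec_eval.Succ)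
qed

lemma computable_const: "computable (\<lambda>x. c)"
  using rec_eval_const[of c] unfolding computable_def by meson

lemma computable_ident: "computable (\<lambda>x. x)"
  unfolding computable_def by (rule exI[of _ "Proj 0"]) (simp add: rec_eval_Proj)

lemma computable_Suc: "computable Suc"
  unfolding computable_def using rec_eval.Succ by meson

lemma computable_comp: "computable f \<Longrightarrow> computable g \<Longrightarrow> computable (\<lambda>x. f (g x))"
proof -
  assume "computable f" "computable g"
  then obtain a b where "\<And>x. rec_eval a [x] (f x)" "\<And>x. rec_eval b [x] (g x)"
    unfolding computable_def by meson
  then have "rec_eval (Comp a [b]) [x] (f (g x))" for x
    by (rule rec_eval_Comp1[rotated])
  then show ?thesis
    unfolding computable_def by meson
qed

lemma computable_comp2:
  "computable2 h \<Longrightarrow> computable f \<Longrightarrow> computable g \<Longrightarrow> computable (\<lambda>x. h (f x) (g x))"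
proof -
  assume "computable2 h" "computable f" "computable g"
  then obtain a b c where h: "\<And>x y. rec_eval a [x, y] (h x y)"
    and "\<And>x. rec_eval b [x] (f x)" "\<And>x. rec_eval c [x] (g x)"
    unfolding computable_def computable2_def by meson
  then have "rec_eval (Comp a [b, c]) [x] (h (f x) (g x))" for x
    by (intro rec_eval_Comp2[OF _ _ h])
  then show ?thesis
    unfolding computable_def by meson
qed

lemma computable2_fst: "computable2 (\<lambda>x y. x)"
  unfolding computable2_def by (rule exI[of _ "Proj 0"]) (simp add: rec_eval_Proj)

lemma computable2_snd: "computable2 (\<lambda>x y. y)"
  unfolding computable2_def by (rule exI[of _ "Proj 1"]) (simp add: rec_eval_Proj)

lemma computable2_const: "computable2 (\<lambda>x y. c)"
  using rec_eval_const[of c] unfolding computable2_def by meson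

lemma computable2_comp: "computable f \<Longrightarrow> computable2 g \<Longrightarrow> computable2 (\<lambda>x y. f (g x y))"
proof -
  assume "computable f" "computable2 g"
  then obtain a b where "\<And>x. rec_eval a [x] (f x)" "\<And>x y. rec_eval b [x, y] (g x y)"
    unfolding computable_def computable2_def by meson
  then have "rec_eval (Comp a [b]) [x, y] (f (g x y))" for x y
    by (rule rec_eval_Comp1[rotated])
  then show ?thesis
    unfolding computable2_def by meson
qed

lemma computable2_comp2:
  "computable2 h \<Longrightarrow> computable2 f \<Longrightarrow> computable2 g \<Longrightarrow> computable2 (\<lambda>x y. h (f x y) (g x y))"
proof -
  assume "computable2 h" "computable2 f" "computable2 g"
  then obtain a b c where h: "\<And>x y. rec_eval a [x, y] (h x y)"
    and "\<And>x y. rec_eval b [x, y] (f x y)" "\<And>x y. rec_eval c [x, y] (g x y)"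
    unfolding computable2_def by meson
  then have "rec_eval (Comp a [b, c]) [x, y] (h (f x y) (g x y))" for x y
    by (intro rec_eval_Comp2[OF _ _ h])
  then show ?thesis
    unfolding computable2_def by meson
qed

lemma computable_rec_nat:
  assumes "computable2 h"
  shows "computable (rec_nat a h)"
proof -
  obtain f where f: "\<And>xs. rec_eval f xs a"
    using rec_eval_const by meson
  obtain g where g: "\<And>x y. rec_eval g [x, y] (h x y)"
    using assms unfolding computable2_def by meson
  show ?thesis
    unfolding computable_def using rec_eval_PrimRec[OF f g] by meson
qed

lemma computable2_iterate:
  assumes "computable h"
  shows "computable2 (\<lambda>n. rec_nat n (\<lambda>i. h))"
proof -
  obtain g where g: "\<And>x. rec_eval g [x] (h x)"
    using assms unfolding computable_def by meson
  have "rec_eval (PrimRec (Proj 0) (Comp g [Proj 1])) [n, a] (rec_nat a (\<lambda>i. h) n)" for n a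
    by (rule rec_eval_PrimRec) (auto intro!: rec_eval_Proj rec_eval_Comp1[OF _ g])
  \<comment> \<open>\<open>PrimRec\<close> recurses on its first argument, so the projections
    exchange the start value and the number of iterations.\<close>
  then have "rec_eval (Comp (PrimRec (Proj 0) (Comp g [Proj 1])) [Proj 1, Proj 0]) [a, n]
      (rec_nat a (\<lambda>i. h) n)" for n a
    by (intro rec_eval_Comp2[where y = n and y' = a]) (auto intro: rec_eval_Proj)
  then show ?thesis
    unfolding computable2_def by meson
qed

section \<open>Elementary arithmetic\<close>

lemma computable2_add: "computable2 (+)"
proof -
  have "rec_nat m (\<lambda>i. Suc) n = m + n" for m n
    by (induction n) auto
  then have "(\<lambda>m. rec_nat m (\<lambda>i. Suc)) = (+)"
    by (intro ext)
  with computable2_iterate[OF computable_Suc] show ?thesis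
    by (simp only:)
qed

lemma computable_pred: "computable (\<lambda>n. n - 1)"
proof -
  have "(\<lambda>n. n - 1) = rec_nat 0 (\<lambda>i r. i)"
  proof
    show "n - 1 = rec_nat 0 (\<lambda>i r. i) n" for n by (cases n) auto
  qed
  then show ?thesis
    using computable_rec_nat[OF computable2_fst] by (simp only:)
qed

lemma computable2_diff: "computable2 (-)"
proof -
  have "rec_nat m (\<lambda>i r. r - 1) n = m - n" for m n
    by (induction n) auto
  then have "(\<lambda>m. rec_nat m (\<lambda>i r. r - 1)) = (-)"
    by (intro ext)
  with computable2_iterate[OF computable_pred] show ?thesis
    by (simp only:)
qed

section \<open>Inverting the pairing function\<close>

lemma computable_triangle: "computable triangle"
proof -
  have "triangle n = rec_nat 0 (\<lambda>i r. r + Suc i) n" for n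
    by (induction n) auto
  then have "triangle = rec_nat 0 (\<lambda>i r. r + Suc i)"
    by (intro ext)
  moreover have "computable2 (\<lambda>i r. r + Suc i)"
    by (intro computable2_comp2[OF computable2_add] computable2_comp[OF computable_Suc]
        computable2_fst computable2_snd)
  ultimately show ?thesis
    using computable_rec_nat[of "\<lambda>i r. r + Suc i" 0] by (simp only:)
qed

text \<open>The largest \<open>r\<close> with \<open>triangle r \<le> n\<close>. From
  \<open>i\<close> to \<open>Suc i\<close> it grows by at most one, and does so when
  \<open>triangle (Suc r) \<le> Suc i\<close>; the truncated difference then vanishes and the outer
  \<open>1 - _\<close> turns this into the increment.\<close>

definition triangle_root :: "nat \<Rightarrow> nat" where
  "triangle_root = rec_nat 0 (\<lambda>i r. r + (1 - (triangle (Suc r) - Suc i)))"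

lemma triangle_root_bounds:
  "triangle (triangle_root n) \<le> n \<and> n < triangle (Suc (triangle_root n))"
proof (induction n)
  case (Suc n)
  have "triangle_root (Suc n) = (if triangle (Suc (triangle_root n)) \<le> Suc n
      then Suc (triangle_root n) else triangle_root n)"
    by (auto simp: triangle_root_def)
  with Suc show ?case by auto
qed (simp add: triangle_root_def)

lemma triangle_mono: "m \<le> n \<Longrightarrow> triangle m \<le> triangle n"
  by (rule lift_Suc_mono_le[of triangle]) auto

text \<open>The code is \<open>triangle (a + b) + a\<close> with \<open>a < Suc (a + b)\<close>, so
  it lies before the next triangular number. Both entries can then be recovered by
  subtraction.\<close>

lemma triangle_root_prod_encode: "triangle_root (prod_encode (a, b)) = a + b"
proof -
  let ?n = "prod_encode (a, b)"
  have "triangle (a + b) \<le> ?n" "?n < triangle (Suc (a + b))"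
    by (auto simp: prod_encode_def)
  with triangle_root_bounds[of ?n]
  have "triangle (a + b) < triangle (Suc (triangle_root ?n))"
    and "triangle (triangle_root ?n) < triangle (Suc (a + b))"
    by linarith+
  then have "a + b < Suc (triangle_root ?n)" "triangle_root ?n < Suc (a + b)"
    by (meson linorder_not_le triangle_mono)+
  then show ?thesis by simp
qed

abbreviation pfst :: "nat \<Rightarrow> nat" where "pfst n \<equiv> fst (prod_decode n)"
abbreviation psnd :: "nat \<Rightarrow> nat" where "psnd n \<equiv> snd (prod_decode n)"

lemma computable_triangle_root: "computable triangle_root"
  unfolding triangle_root_def
  by (intro computable_rec_nat computable2_comp2[OF computable2_add]
      computable2_comp2[OF computable2_diff] computable2_comp[OF computable_triangle]
      computable2_comp[OF computable_Suc] computable2_fst computable2_snd computable2_const)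

lemma pfst_eq: "pfst n = n - triangle (triangle_root n)"
proof -
  obtain a b where "n = prod_encode (a, b)"
    by (metis prod_decode_inverse surj_pair)
  then show ?thesis by (simp add: triangle_root_prod_encode) (simp add: prod_encode_def)
qed

lemma psnd_eq: "psnd n = triangle_root n - pfst n"
proof -
  obtain a b where "n = prod_encode (a, b)"
    by (metis prod_decode_inverse surj_pair)
  then show ?thesis by (simp add: triangle_root_prod_encode)
qed

lemma computable_pfst: "computable f \<Longrightarrow> computable (\<lambda>x. pfst (f x))"
  unfolding pfst_eq
  by (intro computable_comp2[OF computable2_diff] computable_comp[OF computable_triangle]
      computable_comp[OF computable_triangle_root])

lemma computable_psnd: "computable f \<Longrightarrow> computable (\<lambda>x. psnd (f x))"
  unfolding psnd_eq
  by (intro computable_comp2[OF computable2_diff] computable_pfst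
      computable_comp[OF computable_triangle_root])

lemma computable2_prod_encode: "computable2 (\<lambda>x y. prod_encode (x, y))"
  unfolding prod_encode_def prod.case
  by (intro computable2_comp2[OF computable2_add] computable2_comp[OF computable_triangle]
      computable2_fst computable2_snd)

text \<open>Recursion in which start value, step and number of rounds all depend on a parameter.
  Packing parameter, index and previous value into one number keeps every side condition about unary
  functions, so the closure rules can be applied recursively.\<close>

lemma computable_primrec:
  assumes a: "computable a" and n: "computable n"
    and h: "computable (\<lambda>p. h (pfst p) (pfst (psnd p)) (psnd (psnd p)))"
  shows "computable (\<lambda>x. rec_nat (a x) (h x) (n x))"
proof -
  obtain f where f: "\<And>x. rec_eval f [x] (a x)"
    using a unfolding computable_def by meson
  obtain g where g: "\<And>x. rec_eval g [x] (n x)"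
    using n unfolding computable_def by meson
  obtain k where k: "\<And>p. rec_eval k [p] (h (pfst p) (pfst (psnd p)) (psnd (psnd p)))"
    using h unfolding computable_def by meson
  obtain pr where pr: "\<And>x y. rec_eval pr [x, y] (prod_encode (x, y))"
    using computable2_prod_encode unfolding computable2_def by meson
  \<comment> \<open>\<open>PrimRec\<close> supplies the step with the index, the previous value and
    the parameter, in this order; the projections repack them with the parameter first.\<close>
  have "rec_eval (Comp k [Comp pr [Proj 2, Comp pr [Proj 0, Proj 1]]]) [i, r, x] (h x i r)"
    for i r x
    by (rule rec_eval_Comp1[where y = "prod_encode (x, prod_encode (i, r))"],
        rule rec_eval_Comp2[OF _ _ pr], rule rec_eval_Proj,
        simp, simp, rule rec_eval_Comp2[OF _ _ pr])
      (use k[of "prod_encode (x, prod_encode (i, r))"] in \<open>auto intro: rec_eval_Proj\<close>)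
  note * = rec_eval_PrimRec[OF f this]
  have "rec_eval (Comp (PrimRec f (Comp k [Comp pr [Proj 2, Comp pr [Proj 0, Proj 1]]]))
      [g, Proj 0]) [x] (rec_nat (a x) (h x) (n x))" for x
    by (rule rec_eval_Comp2[OF g _ *]) (simp add: rec_eval_Proj)
  then show ?thesis
    unfolding computable_def by meson
qed

named_theorems computable_intros

lemmas [computable_intros] = computable_const computable_ident computable_pfst computable_psnd
  computable_comp[OF computable_Suc] computable_comp2[OF computable2_add]
  computable_comp2[OF computable2_diff] computable_comp2[OF computable2_prod_encode]
  computable_primrec

lemma computable_sum [computable_intros]:
  assumes "computable n" "computable (\<lambda>p. h (pfst p) (psnd p))"
  shows "computable (\<lambda>x. \<Sum>i<n x. h x i)"
proof -
  have "(\<Sum>i<m. h x i) = rec_nat 0 (\<lambda>i r. r + h x i) m" for m x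
    by (induction m) auto
  \<comment> \<open>Here \<open>p\<close> packs the parameter, the index and the partial sum;
    repacking drops the partial sum, on which the summand does not depend.\<close>
  moreover have "computable (\<lambda>p. h (pfst p) (pfst (psnd p)))"
    using computable_comp[OF assms(2), of "\<lambda>p. prod_encode (pfst p, pfst (psnd p))"]
    by (simp add: computable_intros)
  ultimately show ?thesis
    using assms(1) by (simp add: computable_intros)
qed

lemma computable_mult [computable_intros]:
  assumes "computable f" "computable g"
  shows "computable (\<lambda>x. f x * g x)"
proof -
  have "f x * g x = (\<Sum>i<f x. g x)" for x
    by simp
  then show ?thesis
    using assms computable_comp[OF assms(2) computable_pfst[OF computable_ident]]
    by (simp only:) (intro computable_intros; simp)
qed

lemma computable_power2 [computable_intros]:
  assumes "computable f"
  shows "computable (\<lambda>x. 2 ^ f x)"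
proof -
  have "(2 :: nat) ^ n = rec_nat 1 (\<lambda>i r. r + r) n" for n
    by (induction n) auto
  then show ?thesis
    using assms by (simp only:) (intro computable_intros)
qed

section \<open>Decidable predicates and bit tests\<close>

definition decidable :: "(nat \<Rightarrow> bool) \<Rightarrow> bool" where
  "decidable P \<longleftrightarrow> computable (\<lambda>x. of_bool (P x))"

lemma computable_if [computable_intros]:
  assumes "decidable P" "computable f" "computable g"
  shows "computable (\<lambda>x. if P x then f x else g x)"
proof -
  have "(if P x then f x else g x) = of_bool (P x) * f x + (1 - of_bool (P x)) * g x" for x
    by simp
  then show ?thesis
    using assms unfolding decidable_def by (simp only:) (intro computable_intros)
qed

lemma decidable_conj [computable_intros]:
  "decidable P \<Longrightarrow> decidable Q \<Longrightarrow> decidable (\<lambda>x. P x \<and> Q x)"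
  unfolding decidable_def of_bool_conj by (intro computable_intros)

lemma decidable_eq [computable_intros]:
  assumes "computable f" "computable g"
  shows "decidable (\<lambda>x. f x = g x)"
proof -
  have "of_bool (f x = g x) = 1 - ((f x - g x) + (g x - f x))" for x
    by auto
  then show ?thesis
    using assms unfolding decidable_def by (simp only:) (intro computable_intros)
qed

lemma computable_mod2 [computable_intros]:
  assumes "computable f"
  shows "computable (\<lambda>x. f x mod 2)"
proof -
  have "n mod 2 = rec_nat 0 (\<lambda>i r. 1 - r) n" for n :: nat
    by (induction n) (auto simp: mod_Suc)
  then show ?thesis
    using assms by (simp only:) (intro computable_intros)
qed

text \<open>Since \<open>n div 2 + Suc n div 2 = n\<close>, each half is the index minus the
  previous half.\<close>

lemma computable_div2 [computable_intros]:
  assumes "computable f"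
  shows "computable (\<lambda>x. f x div 2)"
proof -
  have "n div 2 = rec_nat 0 (\<lambda>i r. i - r) n" for n :: nat
  proof (induction n)
    case (Suc n)
    have "Suc n div 2 = n - n div 2" by presburger
    with Suc show ?case by simp
  qed simp
  then show ?thesis
    using assms by (simp only:) (intro computable_intros)
qed

text \<open>Membership in a decoded set is the test of one binary digit: halve as often as the
  element says, then look at the parity.\<close>

lemma decidable_set_decode [computable_intros]:
  assumes "computable f" "computable g"
  shows "decidable (\<lambda>x. f x \<in> set_decode (g x))"
proof -
  have *: "m div 2 ^ n = rec_nat m (\<lambda>i r. r div 2) n" for m n :: nat
    by (induction n) (simp_all add: div_mult2_eq power_Suc2 del: power_Suc)
  have "of_bool (f x \<in> set_decode (g x)) = rec_nat (g x) (\<lambda>i r. r div 2) (f x) mod 2" for x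
    unfolding set_decode_def *[symmetric] by (simp add: mod2_eq_if)
  then show ?thesis
    using assms unfolding decidable_def by (simp only:) (intro computable_intros)
qed

subsection \<open>Codes of lists\<close>

text \<open>A nonempty list is coded by the successor of the pair of head and tail, so
  \<open>r - 1\<close> exposes the pair. The code 0 of the empty list is a fixed point, because
  \<open>0 - 1 = 0\<close> decodes to \<open>(0, 0)\<close>.\<close>

definition drop_code :: "nat \<Rightarrow> nat \<Rightarrow> nat" where
  "drop_code l = rec_nat l (\<lambda>i r. psnd (r - 1))"

definition hd_code :: "nat \<Rightarrow> nat" where
  "hd_code l = pfst (l - 1)"

text \<open>Primitive recursion descends by one, not to the code of the tail, so the result is built
  from the end of the list: after \<open>m\<close> rounds it codes the mapped suffix from position
  \<open>l - m\<close>. As \<open>l\<close> bounds the length, \<open>l\<close> rounds suffice;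
  rounds that meet an empty suffix return 0.\<close>

definition map_code :: "(nat \<Rightarrow> nat) \<Rightarrow> nat \<Rightarrow> nat" where
  "map_code g l = rec_nat 0 (\<lambda>i r. if drop_code l (l - Suc i) = 0 then 0
     else Suc (prod_encode (g (hd_code (drop_code l (l - Suc i))), r))) l"

lemma prod_decode_0 [simp]: "prod_decode 0 = (0, 0)"
  by (simp add: prod_decode_def prod_decode_aux.simps)

lemma drop_code_list_encode: "drop_code (list_encode xs) n = list_encode (drop n xs)"
proof (induction n)
  case (Suc n)
  then have "drop_code (list_encode xs) (Suc n) = psnd (list_encode (drop n xs) - 1)"
    by (simp add: drop_code_def)
  also have "\<dots> = list_encode (drop (Suc n) xs)"
    unfolding drop_Suc tl_drop[symmetric] by (cases "drop n xs") (simp_all del: drop_eq_Nil)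
  finally show ?case .
qed (simp add: drop_code_def)

lemma hd_code_list_encode: "hd_code (list_encode (x # xs)) = x"
  by (simp add: hd_code_def)

text \<open>The first bound gives \<open>map_code\<close> enough rounds; the second bounds the data
  of an instance by its code.\<close>

lemma list_encode_ge:
  "length xs \<le> list_encode xs" "x \<in> set xs \<Longrightarrow> x \<le> list_encode xs"
proof (induction xs)
  case (Cons y ys)
  have "y \<le> prod_encode (y, list_encode ys)" "list_encode ys \<le> prod_encode (y, list_encode ys)"
    by (rule le_prod_encode_1 le_prod_encode_2)+
  {
    case 1
    then show ?case using Cons.IH(1) \<open>list_encode ys \<le> _\<close> by simp
  next
    case 2
    then show ?case using Cons.IH(2) \<open>y \<le> _\<close> \<open>list_encode ys \<le> _\<close> by fastforce
  }
qed auto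

lemma map_code_list_encode: "map_code g (list_encode xs) = list_encode (map g xs)"
proof -
  let ?l = "list_encode xs"
  let ?h = "\<lambda>i r. if drop_code ?l (?l - Suc i) = 0 then 0
     else Suc (prod_encode (g (hd_code (drop_code ?l (?l - Suc i))), r))"
  have "rec_nat 0 ?h m = list_encode (map g (drop (?l - m) xs))" if "m \<le> ?l" for m
    using that
  proof (induction m)
    case 0
    show ?case using list_encode_ge(1)[of xs] by simp
  next
    case (Suc m)
    have d: "?l - m = Suc (?l - Suc m)" using Suc.prems by simp
    show ?case
    proof (cases "drop (?l - Suc m) xs")
      case Nil
      then show ?thesis
        by (simp add: drop_code_list_encode)
    next
      case (Cons y ys)
      then have "drop (?l - m) xs = ys"
        unfolding d by (metis drop_Suc list.sel(3) tl_drop)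
      then show ?thesis
        using Suc Cons by (simp add: drop_code_list_encode hd_code_def)
    qed
  qed
  from this[of ?l] show ?thesis
    by (simp add: map_code_def)
qed

lemma computable_drop_code [computable_intros]:
  "computable f \<Longrightarrow> computable g \<Longrightarrow> computable (\<lambda>x. drop_code (f x) (g x))"
  unfolding drop_code_def by (intro computable_intros)

lemma computable_hd_code [computable_intros]:
  "computable f \<Longrightarrow> computable (\<lambda>x. hd_code (f x))"
  unfolding hd_code_def by (intro computable_intros)

lemma computable_map_code:
  assumes l: "computable l" and g: "computable (\<lambda>p. g (pfst p) (psnd p))"
  shows "computable (\<lambda>x. map_code (g x) (l x))"
proof -
  have g': "computable (\<lambda>p. g (pfst p) (h p))" if "computable h" for h
    using computable_comp[OF g, of "\<lambda>p. prod_encode (pfst p, h p)"] that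
    by (simp add: computable_intros)
  have l': "computable (\<lambda>p. l (pfst p))"
    by (rule computable_comp[OF l computable_pfst[OF computable_ident]])
  show ?thesis
    unfolding map_code_def by (intro computable_intros l l' g')
qed


section \<open>Copies of a transition system moving in lockstep\<close>

text \<open>The state of a composite of \<open>Suc n\<close> copies that are all in state
  \<open>s\<close>; the nesting to the left follows the \<open>foldl\<close> in
  \<open>ts_comp_list\<close>.\<close>

fun diag :: "nat \<Rightarrow> nat \<Rightarrow> nat" where
  "diag 0 s = s"
| "diag (Suc n) s = prod_encode (diag n s, s)"

lemma diag_inj [simp]: "diag n s = diag n s' \<longleftrightarrow> s = s'"
  by (cases n) auto

text \<open>The systems \<open>Ts\<close> being copies of \<open>B\<close> up to labels and interface, \<open>U\<close> is their composite:
  from the diagonal, it can only move along the diagonal.\<close>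

definition lockstep ::
  "nat \<Rightarrow> (nat, 'c, 'o) ts \<Rightarrow> (nat, 'c, 'o) ts \<Rightarrow> (nat, 'c, 'o) ts list \<Rightarrow> bool" where
  "lockstep n U B Ts \<longleftrightarrow>
     t_init U = diag n (t_init B) \<and>
     t_chans U = (\<Union>T\<in>set Ts. t_chans T) \<and>
     (\<forall>s\<in>t_states B. diag n s \<in> t_states U \<and> t_ls U (diag n s) = t_ls B s \<and>
        t_lab U (diag n s) = (\<Union>T\<in>set Ts. fst (t_lab T s), \<Union>T\<in>set Ts. snd (t_lab T s)) \<and>
        (\<forall>c u. (diag n s, c, u) \<in> t_trans U \<longleftrightarrow> (\<exists>s'. u = diag n s' \<and> (s, c, s') \<in> t_trans B)))"

definition copy_of :: "(nat, 'c, 'o) ts \<Rightarrow> (nat, 'c, 'o) ts \<Rightarrow> bool" where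
  "copy_of B T \<longleftrightarrow> t_states T = t_states B \<and> t_init T = t_init B \<and> t_ls T = t_ls B \<and>
     t_trans T = t_trans B"

text \<open>Besides unique successors, the listened channels must be exactly the enabled ones: a
  component that does not listen stays put in a composition, which would separate the
  copies.\<close>

definition deterministic_ts :: "('s, 'c, 'o) ts \<Rightarrow> bool" where
  "deterministic_ts B \<longleftrightarrow>
     t_trans B \<subseteq> {(s, c, s'). s \<in> t_states B \<and> s' \<in> t_states B \<and> c \<in> t_ls B s} \<and>
     (\<forall>s c s' s''. (s, c, s') \<in> t_trans B \<longrightarrow> (s, c, s'') \<in> t_trans B \<longrightarrow> s' = s'') \<and>
     (\<forall>s\<in>t_states B. \<forall>c\<in>t_ls B s. \<exists>s'. (s, c, s') \<in> t_trans B)"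

lemma lockstep_single: "copy_of B T \<Longrightarrow> lockstep 0 T B [T]"
  by (auto simp: lockstep_def copy_of_def)

text \<open>Both sides listen to the same channels, so no alternative in which one of them stays put
  applies. Each of the three ownership cases thus reduces to a joint move, and determinism makes the
  two successors agree.\<close>

lemma comp_trans_lockstep:
  assumes B: "deterministic_ts B" and T: "copy_of B T" and U: "lockstep n U B Ts"
    and s: "s \<in> t_states B"
  shows "comp_trans U T (diag n s, s) c (u, v) \<longleftrightarrow> u = diag n v \<and> (s, c, v) \<in> t_trans B"
proof -
  have U': "(diag n s, c, u) \<in> t_trans U \<longleftrightarrow> (\<exists>s'. u = diag n s' \<and> (s, c, s') \<in> t_trans B)" for u
    using U s by (simp add: lockstep_def)
  have ls: "t_ls U (diag n s) = t_ls B s"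
    using U s by (simp add: lockstep_def)
  have mem: "c \<in> t_ls B s" if "(s, c, s') \<in> t_trans B" for s'
    using B that by (auto simp: deterministic_ts_def)
  have det: "s' = s''" if "(s, c, s') \<in> t_trans B" "(s, c, s'') \<in> t_trans B" for s' s''
    using B that unfolding deterministic_ts_def by blast
  show ?thesis
    using T unfolding comp_trans_def copy_of_def prod.case U' ls
    by (auto dest: mem det)
qed

lemma lockstep_comp:
  assumes B: "deterministic_ts B" and T: "copy_of B T" and U: "lockstep n U B Ts"
  shows "lockstep (Suc n) (pair_rename (ts_comp U T)) B (Ts @ [T])"
proof -
  have trans: "(diag (Suc n) s, c, u) \<in> t_trans (pair_rename (ts_comp U T)) \<longleftrightarrow>
      (\<exists>s'. u = diag (Suc n) s' \<and> (s, c, s') \<in> t_trans B)" if s: "s \<in> t_states B" for s c u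
  proof -
    have "(diag (Suc n) s, c, u) \<in> t_trans (pair_rename (ts_comp U T)) \<longleftrightarrow>
        (\<exists>v v'. u = prod_encode (v, v') \<and> v \<in> t_states U \<and> v' \<in> t_states B \<and>
           comp_trans U T (diag n s, s) c (v, v'))"
      using s U T by (auto simp: pair_rename_def ts_comp_def lockstep_def copy_of_def)
    also have "\<dots> \<longleftrightarrow> (\<exists>s'. u = diag (Suc n) s' \<and> (s, c, s') \<in> t_trans B)"
      unfolding comp_trans_lockstep[OF B T U s]
      using U B by (auto simp: lockstep_def deterministic_ts_def)
    finally show ?thesis .
  qed
  show ?thesis
    using U T unfolding lockstep_def
    by (intro conjI ballI allI trans)
      (auto simp: pair_rename_def ts_comp_def copy_of_def)
qed

text \<open>Partial composites also move on channels owned by none of their members, so the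
  invariant uses a fixed set \<open>C\<close>. It becomes communication closure once the blocks
  cover all inputs.\<close>

lemma comm_closed_pair_rename_comp:
  assumes "t_trans U \<subseteq> t_states U \<times> C \<times> t_states U" "t_trans T \<subseteq> t_states T \<times> C \<times> t_states T"
  shows "t_trans (pair_rename (ts_comp U T)) \<subseteq>
    t_states (pair_rename (ts_comp U T)) \<times> C \<times> t_states (pair_rename (ts_comp U T))"
  using assms by (auto simp: pair_rename_def ts_comp_def comp_trans_def)

text \<open>The typing of transitions is carried along separately because communication closure
  concerns all transitions, while \<open>lockstep\<close> constrains only those leaving the
  diagonal.\<close>

lemma lockstep_foldl:
  assumes B: "deterministic_ts B" and "lockstep n U B Ts" and "\<forall>T\<in>set Ts'. copy_of B T"
    and "t_trans U \<subseteq> t_states U \<times> C \<times> t_states U" and "t_trans B \<subseteq> t_states B \<times> C \<times> t_states B"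
  shows "lockstep (n + length Ts') (foldl (\<lambda>T T'. pair_rename (ts_comp T T')) U Ts') B (Ts @ Ts') \<and>
    t_trans (foldl (\<lambda>T T'. pair_rename (ts_comp T T')) U Ts') \<subseteq>
      t_states (foldl (\<lambda>T T'. pair_rename (ts_comp T T')) U Ts') \<times> C \<times>
      t_states (foldl (\<lambda>T T'. pair_rename (ts_comp T T')) U Ts')"
  using assms(2-)
proof (induction Ts' arbitrary: n U Ts)
  case (Cons T Ts')
  have T: "copy_of B T" using Cons.prems(2) by simp
  have "t_trans T \<subseteq> t_states T \<times> C \<times> t_states T"
    using T Cons.prems(4) by (simp add: copy_of_def)
  from Cons.IH[OF lockstep_comp[OF B T Cons.prems(1)] _ comm_closed_pair_rename_comp[OF _ this]]
  show ?case
    using Cons.prems by simp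
qed simp

lemma lockstep_comp_list:
  assumes "deterministic_ts B" "Ts \<noteq> []" "\<forall>T\<in>set Ts. copy_of B T"
    and "t_trans B \<subseteq> t_states B \<times> C \<times> t_states B"
  shows "lockstep (length Ts - 1) (ts_comp_list Ts) B Ts"
    and "t_trans (ts_comp_list Ts) \<subseteq> t_states (ts_comp_list Ts) \<times> C \<times> t_states (ts_comp_list Ts)"
proof -
  obtain T Ts' where Ts: "Ts = T # Ts'" using assms(2) by (cases Ts) auto
  have "lockstep 0 T B [T]" "t_trans T \<subseteq> t_states T \<times> C \<times> t_states T"
    using assms(3,4) lockstep_single by (auto simp: Ts copy_of_def)
  from lockstep_foldl[OF assms(1) this(1) _ this(2) assms(4), of Ts']
  show "lockstep (length Ts - 1) (ts_comp_list Ts) B Ts"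
    and "t_trans (ts_comp_list Ts) \<subseteq> t_states (ts_comp_list Ts) \<times> C \<times> t_states (ts_comp_list Ts)"
    using assms(3) by (auto simp: Ts ts_comp_list_def)
qed

lemma ts_run_lockstep:
  assumes B: "deterministic_ts B" "t_init B \<in> t_states B" and U: "lockstep n U B Ts"
  shows "ts_run U w c \<longleftrightarrow> (\<exists>s. w = diag n \<circ> s \<and> ts_run B s c)"
proof
  assume w: "ts_run U w c"
  have "\<exists>s. s \<in> t_states B \<and> w k = diag n s" for k
  proof (induction k)
    case 0
    show ?case using w U B(2) by (auto simp: ts_run_def lockstep_def)
  next
    case (Suc k)
    then obtain s where s: "s \<in> t_states B" "w k = diag n s" by blast
    have "(w k, c k, w (Suc k)) \<in> t_trans U" using w by (simp add: ts_run_def)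
    then obtain s' where "w (Suc k) = diag n s'" "(s, c k, s') \<in> t_trans B"
      using U s by (auto simp: lockstep_def)
    then show ?case using B(1) by (auto simp: deterministic_ts_def)
  qed
  then obtain s where s: "\<And>k. s k \<in> t_states B" "\<And>k. w k = diag n (s k)" by metis
  have "ts_run B s c"
    using w U s by (auto simp: ts_run_def lockstep_def)
  then show "\<exists>s. w = diag n \<circ> s \<and> ts_run B s c"
    using s(2) by (auto simp: fun_eq_iff)
next
  assume "\<exists>s. w = diag n \<circ> s \<and> ts_run B s c"
  then obtain s where s: "w = diag n \<circ> s" "ts_run B s c" by blast
  \<comment> \<open>Each state of an infinite run is the source of a transition, hence belongs to
    the state set.\<close>
  have "s k \<in> t_states B" for k
    using s(2) B(1) by (fastforce simp: ts_run_def deterministic_ts_def)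
  then show "ts_run U w c"
    using s U by (auto simp: ts_run_def lockstep_def)
qed

section \<open>The components\<close>

definition enc_state :: "(nat, nat) letter \<times> nat \<Rightarrow> nat" where
  "enc_state = (\<lambda>(l, q). prod_encode (enc_letter l, q))"

definition state_chan :: "nat \<Rightarrow> nat" where
  "state_chan s = pfst (pfst s)"

definition state_outs :: "nat \<Rightarrow> nat set" where
  "state_outs s = set_decode (psnd (pfst s))"

lemma state_chan_enc_state [simp]: "state_chan (enc_state (l, q)) = fst l"
  by (simp add: state_chan_def enc_state_def enc_letter_def split: prod.splits)

lemma state_outs_enc_state [simp]: "finite (snd l) \<Longrightarrow> state_outs (enc_state (l, q)) = snd l"
  by (auto simp: state_outs_def enc_state_def enc_letter_def split: prod.splits)

lemma psnd_enc_state [simp]: "psnd (enc_state (l, q)) = q"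
  by (simp add: enc_state_def)

lemma enc_mtrans_eq: "enc_mtrans (q, l, q') = prod_encode (q, enc_state (l, q'))"
  by (simp add: enc_mtrans_def enc_state_def)

text \<open>A state consists of the letter just read and of a state of the machine. All numbers up to
  a bound \<open>N\<close> are admitted as states, which saves computing the reachable ones. \<open>D\<close> is the
  set of codes of the transitions of the machine; the second part of such a code is the code of
  the state of the component after the transition.\<close>

definition component :: "nat set \<Rightarrow> nat \<Rightarrow> nat \<Rightarrow> nat set \<times> nat set \<Rightarrow> (nat, nat, nat) ts" where
  "component D N i = (\<lambda>(Y, O'). \<lparr>
     t_states = {..N},
     t_init = i,
     t_chans = Y,
     t_outs = O',
     t_ls = (\<lambda>s. state_chan ` psnd ` {t \<in> D. pfst t = psnd s}),
     t_lab = (\<lambda>s. ({state_chan s} \<inter> Y, state_outs s \<inter> O')),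
     t_trans = (\<lambda>(s, t). (s, state_chan (psnd t), psnd t)) `
       {(s, t) \<in> {..N} \<times> D. pfst t = psnd s} \<rparr>)"

lemma component_simps [simp]:
  "t_states (component D N i b) = {..N}"
  "t_init (component D N i b) = i"
  "t_chans (component D N i b) = fst b"
  "t_outs (component D N i b) = snd b"
  "t_ls (component D N i b) = (\<lambda>s. state_chan ` psnd ` {t \<in> D. pfst t = psnd s})"
  "t_lab (component D N i b) = (\<lambda>s. ({state_chan s} \<inter> fst b, state_outs s \<inter> snd b))"
  "t_trans (component D N i b) = (\<lambda>(s, t). (s, state_chan (psnd t), psnd t)) `
       {(s, t) \<in> {..N} \<times> D. pfst t = psnd s}"
  by (simp_all add: component_def split: prod.splits)

section \<open>Runs of the components and runs of the machine\<close>

context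
  fixes M :: "(nat, nat, nat) mealy" and N :: nat
  assumes M: "is_mealy M" "finite_mealy M"
    and N: "enc_state (m_init M) \<le> N" "\<And>t. t \<in> m_trans M \<Longrightarrow> enc_mtrans t \<le> N"
begin

abbreviation (input) "comps \<equiv> component (enc_mtrans ` m_trans M) N (enc_state (m_init M))"

lemma mtrans_alphabet:
  assumes "(q, l, q') \<in> m_trans M"
  shows "fst l \<in> m_inputs M \<and> snd l \<subseteq> m_outputs M \<and> finite (snd l)"
proof -
  have "m_trans M \<subseteq> m_states M \<times> (m_inputs M \<times> Pow (m_outputs M)) \<times> m_states M"
    using M(1) by (simp add: is_mealy_def)
  with assms have "l \<in> m_inputs M \<times> Pow (m_outputs M)"
    by blast
  then have "fst l \<in> m_inputs M" "snd l \<subseteq> m_outputs M"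
    by auto
  moreover have "finite (m_outputs M)"
    using M(2) by (simp add: finite_mealy_def)
  ultimately show ?thesis
    using finite_subset by blast
qed

lemma mtrans_deterministic:
  "(q, l, q') \<in> m_trans M \<Longrightarrow> (q, l', q'') \<in> m_trans M \<Longrightarrow> fst l = fst l' \<Longrightarrow> l = l' \<and> q' = q''"
  using M(1) unfolding is_mealy_def by (cases l; cases l'; simp; blast)

text \<open>The target state is the second entry of the transition code and a pair bounds its
  entries, so moves do not leave \<open>{..N}\<close>.\<close>

lemma mtrans_bound: "(q, l, q') \<in> m_trans M \<Longrightarrow> enc_state (l, q') \<le> N"
  using N(2)[of "(q, l, q')"] le_prod_encode_2[of "enc_state (l, q')" q]
  by (simp add: enc_mtrans_eq)

text \<open>Moves depend on \<open>s\<close> only through the machine state \<open>psnd s\<close>;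
  the stored letter affects labels alone. Hence numbers that code no reachable state do no
  harm.\<close>

lemma component_trans:
  "(s, c, s') \<in> t_trans (comps b) \<longleftrightarrow>
     s \<le> N \<and> (\<exists>l q'. (psnd s, l, q') \<in> m_trans M \<and> c = fst l \<and> s' = enc_state (l, q'))"
proof -
  have "(s, c, s') \<in> t_trans (comps b) \<longleftrightarrow>
     s \<le> N \<and> (\<exists>t\<in>m_trans M. fst t = psnd s \<and> c = fst (fst (snd t)) \<and> s' = enc_state (snd t))"
    by (force simp: enc_mtrans_eq image_iff)
  then show ?thesis by force
qed

lemma component_ls:
  "c \<in> t_ls (comps b) s \<longleftrightarrow> (\<exists>l q'. (psnd s, l, q') \<in> m_trans M \<and> c = fst l)"
proof -
  have "c \<in> t_ls (comps b) s \<longleftrightarrow> (\<exists>t\<in>m_trans M. fst t = psnd s \<and> c = fst (fst (snd t)))"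
    by (force simp: enc_mtrans_eq image_iff)
  then show ?thesis by force
qed

lemma component_deterministic: "deterministic_ts (comps b)"
  unfolding deterministic_ts_def
proof (intro conjI allI impI ballI)
  show "t_trans (comps b) \<subseteq> {(s, c, s'). s \<in> t_states (comps b) \<and> s' \<in> t_states (comps b) \<and>
      c \<in> t_ls (comps b) s}"
    using mtrans_bound by (clarsimp simp: component_trans component_ls simp del: component_simps(5,7)) blast
  show "s' = s''" if "(s, c, s') \<in> t_trans (comps b)" "(s, c, s'') \<in> t_trans (comps b)" for s c s' s''
    using that mtrans_deterministic unfolding component_trans by metis
  show "\<exists>s'. (s, c, s') \<in> t_trans (comps b)"
    if "s \<in> t_states (comps b)" "c \<in> t_ls (comps b) s" for s c
    using that by (auto simp: component_trans component_ls simp del: component_simps(5,7))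
qed

text \<open>The target of a move stores the channel just used, so on an owned channel
  \<open>c\<close> the label \<open>{c} \<inter> fst b\<close> contains \<open>c\<close>.\<close>

lemma component_is_ts:
  assumes "fst b \<subseteq> m_inputs M"
  shows "is_ts (m_inputs M) (comps b)"
  unfolding is_ts_def
proof (intro conjI ballI allI impI)
  show "t_trans (comps b) \<subseteq> t_states (comps b) \<times> m_inputs M \<times> t_states (comps b)"
    using mtrans_bound mtrans_alphabet
    by (auto simp: component_trans simp del: component_simps(7))
  show "t_ls (comps b) s \<subseteq> m_inputs M" for s
    using mtrans_alphabet by (auto simp: component_ls simp del: component_simps(5))
  show "(\<exists>s'. (s, c, s') \<in> t_trans (comps b)) \<longleftrightarrow> c \<in> t_ls (comps b) s"
    if "s \<in> t_states (comps b)" for s c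
    using that by (auto simp: component_trans component_ls simp del: component_simps(5,7))
  show "c \<in> fst (t_lab (comps b) s')"
    if "c \<in> t_chans (comps b)" "(s, c, s') \<in> t_trans (comps b)" for s c s'
    using that by (auto simp: component_trans simp del: component_simps(7))
qed (use assms N(1) in auto)

lemma component_run:
  "(\<exists>c. ts_run (comps b) s c) \<longleftrightarrow> (\<exists>w q. mealy_run M w q \<and> s = (\<lambda>k. enc_state (w k, q k)))"
proof
  assume "\<exists>c. ts_run (comps b) s c"
  then obtain c where s: "s 0 = enc_state (m_init M)"
    and step: "\<And>k. (s k, c k, s (Suc k)) \<in> t_trans (comps b)"
    by (auto simp: ts_run_def)
  define w where "w k = (state_chan (s k), state_outs (s k))" for k
  define q where "q k = psnd (s k)" for k
  \<comment> \<open>\<open>set_decode\<close> recovers a set of outputs only if it is finite; later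
    letters get this from \<open>mtrans_alphabet\<close>.\<close>
  have fin: "finite (snd (fst (m_init M)))"
    using M by (auto simp: is_mealy_def finite_mealy_def dest: finite_subset)
  have 0: "(w 0, q 0) = m_init M"
    using s fin by (cases "m_init M") (auto simp: w_def q_def)
  have Suc: "(q k, w (Suc k), q (Suc k)) \<in> m_trans M \<and>
      s (Suc k) = enc_state (w (Suc k), q (Suc k))" for k
    using step[of k] mtrans_alphabet unfolding component_trans
    by (auto simp: w_def q_def)
  have "s k = enc_state (w k, q k)" for k
    using 0 Suc s by (cases k) auto
  then show "\<exists>w q. mealy_run M w q \<and> s = (\<lambda>k. enc_state (w k, q k))"
    using 0 Suc by (auto simp: mealy_run_def fun_eq_iff)
next
  assume "\<exists>w q. mealy_run M w q \<and> s = (\<lambda>k. enc_state (w k, q k))"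
  then obtain w q where run: "mealy_run M w q" and s: "s = (\<lambda>k. enc_state (w k, q k))" by blast
  have "s k \<le> N" for k
  proof (cases k)
    case 0
    then show ?thesis using run s N(1) by (simp add: mealy_run_def)
  next
    case (Suc m)
    then have "(q m, w k, q k) \<in> m_trans M" using run by (simp add: mealy_run_def)
    then show ?thesis using s mtrans_bound by blast
  qed
  \<comment> \<open>The shift by one: \<open>s k\<close> stores the letter \<open>w k\<close> that
    led to it, so the channel leaving \<open>s k\<close> is that of the next letter.\<close>
  then have "ts_run (comps b) s (\<lambda>k. fst (w (Suc k)))"
    using run unfolding ts_run_def component_trans by (fastforce simp: mealy_run_def s)
  then show "\<exists>c. ts_run (comps b) s c" by blast
qed

lemma mealy_run_alphabet:
  assumes "mealy_run M w q"
  shows "w k \<in> m_inputs M \<times> Pow (m_outputs M)"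
proof (cases k)
  case 0
  have "m_init M = (w 0, q 0)"
    using assms by (simp add: mealy_run_def)
  moreover have "m_init M \<in> (m_inputs M \<times> Pow (m_outputs M)) \<times> m_states M"
    using M(1) by (simp add: is_mealy_def)
  ultimately show ?thesis
    using 0 by simp
next
  case (Suc m)
  then have "(q m, w k, q k) \<in> m_trans M"
    using assms by (simp add: mealy_run_def)
  from mtrans_alphabet[OF this] show ?thesis by (cases "w k") auto
qed

lemma components_solution:
  assumes P: "teamwork_instance (M, P)"
  shows "teamwork_solution (M, P) (map comps P)"
proof -
  \<comment> \<open>\<open>copy_of\<close> ignores labels and interface, so the component with the
    empty interface can serve as the common model of all.\<close>
  let ?Ts = "map comps P" and ?B = "comps ({}, {})"
  let ?U = "ts_comp_list ?Ts" and ?I = "\<lambda>(c :: nat, A :: nat set). ({c}, A)"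
  have "set P = (!) P ` {..<length P}"
    using set_conv_nth[of P] by blast
  then have in_eq: "(\<Union>b\<in>set P. fst b) = m_inputs M" and out_eq: "(\<Union>b\<in>set P. snd b) = m_outputs M"
    using P by (simp_all add: teamwork_instance_def image_image)
  have ne: "?Ts \<noteq> []"
    using in_eq M(1) by (cases P) (auto simp: is_mealy_def)
  have copies: "\<forall>T\<in>set ?Ts. copy_of ?B T"
    by (simp add: copy_of_def)
  have "t_trans ?B \<subseteq> t_states ?B \<times> m_inputs M \<times> t_states ?B"
    using component_is_ts[of "({}, {})"] by (simp add: is_ts_def del: component_simps)
  note U = lockstep_comp_list[OF component_deterministic ne copies this]
  have chans: "t_chans ?U = m_inputs M"
    using U(1) in_eq by (simp add: lockstep_def)
  \<comment> \<open>Each copy shows the part of the letter in its own block; as the blocks cover the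
    interface, the union restores the whole letter.\<close>
  have lab: "t_lab ?U (diag (length ?Ts - 1) (enc_state (w k, q k))) = ?I (w k)"
    if run: "mealy_run M w q" for w q k
  proof -
    obtain c A where w: "w k = (c, A)" by fastforce
    have cA: "c \<in> m_inputs M" "A \<subseteq> m_outputs M"
      using mealy_run_alphabet[OF run, of k] w by auto
    moreover have "finite A"
      using cA M(2) by (auto simp: finite_mealy_def dest: finite_subset)
    ultimately have "(\<Union>b\<in>set P. {c} \<inter> fst b) = {c}" "(\<Union>b\<in>set P. A \<inter> snd b) = A" "finite A"
      unfolding in_eq[symmetric] out_eq[symmetric] by blast+
    \<comment> \<open>\<open>lockstep\<close> describes labels only for states of \<open>?B\<close>;
      membership follows because the state occurs as the source of a move in a run.\<close>
    moreover obtain d where "ts_run ?B (\<lambda>k. enc_state (w k, q k)) d"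
      using component_run[of "({}, {})" "\<lambda>k. enc_state (w k, q k)"] run by blast
    then have "(enc_state (w k, q k), d k, enc_state (w (Suc k), q (Suc k))) \<in> t_trans ?B"
      by (simp add: ts_run_def)
    then have "enc_state (w k, q k) \<in> t_states ?B"
      by auto
    ultimately show ?thesis
      using U(1) w by (simp add: lockstep_def image_image)
  qed
  have "ts_lang ?U = (\<lambda>w. ?I \<circ> w) ` mealy_lang M"
  proof -
    define L where "L s = (\<lambda>k. t_lab ?U (diag (length ?Ts - 1) (s k)))" for s :: "nat \<Rightarrow> nat"
    have "ts_run ?U v c \<longleftrightarrow> (\<exists>s. v = diag (length ?Ts - 1) \<circ> s \<and> ts_run ?B s c)" for v c
      by (rule ts_run_lockstep[OF component_deterministic _ U(1)]) (use N(1) in simp)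
    then have "ts_lang ?U = {L s |s. \<exists>c. ts_run ?B s c}"
      unfolding ts_lang_def L_def by (auto simp: comp_def)
    also have "\<dots> = {L (\<lambda>k. enc_state (w k, q k)) |w q. mealy_run M w q}"
      unfolding component_run by blast
    also have "\<dots> = {(\<lambda>k. ?I (w k)) |w q. mealy_run M w q}"
    proof -
      have "L (\<lambda>k. enc_state (w k, q k)) = (\<lambda>k. ?I (w k))" if "mealy_run M w q" for w q
        unfolding L_def using lab[OF that] by (intro ext)
      then show ?thesis by (metis (no_types, lifting))
    qed
    also have "\<dots> = (\<lambda>w. ?I \<circ> w) ` mealy_lang M"
      unfolding mealy_lang_def comp_def by blast
    finally show ?thesis .
  qed
  moreover have "bij_betw ?I (m_inputs M \<times> Pow (m_outputs M))
      ((\<lambda>c. {c}) ` m_inputs M \<times> Pow (m_outputs M))"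
    by (auto simp: bij_betw_def inj_on_def image_iff)
  ultimately have "lang_iso (m_inputs M \<times> Pow (m_outputs M))
      ((\<lambda>c. {c}) ` m_inputs M \<times> Pow (m_outputs M)) (mealy_lang M) (ts_lang ?U)"
    unfolding lang_iso_def by blast
  moreover have "comm_closed ?U"
    using U(2) by (simp add: comm_closed_def chans)
  moreover have "is_ts (m_inputs M) (comps (P ! k))" if "k < length P" for k
    using that in_eq by (intro component_is_ts) auto
  ultimately show ?thesis
    by (simp add: teamwork_solution_def)
qed

end

section \<open>Computing the components\<close>

text \<open>Without injectivity a power of 2 would be added twice and carry into another binary
  digit.\<close>

lemma set_encode_image:
  assumes "finite A" "inj_on g {a \<in> A. P a}"
  shows "set_encode (g ` {a \<in> A. P a}) = (\<Sum>a\<in>A. if P a then 2 ^ g a else 0)"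
  using assms by (simp add: set_encode_def sum.reindex sum.inter_filter)

definition ls_code :: "nat \<Rightarrow> nat \<Rightarrow> nat \<Rightarrow> nat" where
  "ls_code D N s = (\<Sum>t<Suc N. if t \<in> set_decode D \<and> pfst t = psnd s
     then 2 ^ state_chan (psnd t) else 0)"

definition chan_label_code :: "nat \<Rightarrow> nat \<Rightarrow> nat" where
  "chan_label_code Y s = (if state_chan s \<in> set_decode Y then 2 ^ state_chan s else 0)"

definition out_label_code :: "nat \<Rightarrow> nat \<Rightarrow> nat \<Rightarrow> nat" where
  "out_label_code N O' s = (\<Sum>o'<Suc N. if o' \<in> set_decode (psnd (pfst s)) \<and> o' \<in> set_decode O'
     then 2 ^ o' else 0)"

definition trans_code :: "nat \<Rightarrow> nat \<Rightarrow> nat" where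
  "trans_code D N = (\<Sum>s<Suc N. \<Sum>t<Suc N. if t \<in> set_decode D \<and> pfst t = psnd s
     then 2 ^ prod_encode (s, prod_encode (state_chan (psnd t), psnd t)) else 0)"

definition component_code :: "nat \<Rightarrow> nat \<Rightarrow> nat \<Rightarrow> nat \<Rightarrow> nat" where
  "component_code D N i b = list_encode
     [\<Sum>s<Suc N. 2 ^ s, i, pfst b, psnd b,
      \<Sum>s<Suc N. 2 ^ prod_encode (s, ls_code D N s),
      \<Sum>s<Suc N. 2 ^ prod_encode (s, prod_encode (chan_label_code (pfst b) s, out_label_code N (psnd b) s)),
      trans_code D N]"

text \<open>Positions 4 and 3 of the list in \<open>enc_mealy\<close> hold the transitions and the
  initial state. The bound on the states is the whole input \<open>x\<close>.\<close>

definition solution_code :: "nat \<Rightarrow> nat" where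
  "solution_code x = map_code (component_code (hd_code (drop_code (pfst x) 4)) x
     (hd_code (drop_code (pfst x) 3))) (psnd x)"

lemma computable_component_code [computable_intros]:
  assumes "computable D" "computable N" "computable i" "computable b"
  shows "computable (\<lambda>x. component_code (D x) (N x) (i x) (b x))"
proof -
  \<comment> \<open>Every summation variable is paired with the parameter, so the parameter is found
    behind one \<open>pfst\<close> in a single sum and behind two in a nested one.\<close>
  have *: "computable (\<lambda>p. f (pfst p))" "computable (\<lambda>p. f (pfst (pfst p)))" if "computable f" for f
    using computable_comp[OF that] by (simp_all add: computable_pfst computable_ident)
  show ?thesis
    unfolding component_code_def ls_code_def chan_label_code_def out_label_code_def trans_code_def
      state_chan_def list_encode.simps
    by (intro computable_intros assms *[OF assms(1)] *[OF assms(2)] *[OF assms(4)])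
qed

lemma computable_solution_code: "computable solution_code"
  unfolding solution_code_def by (intro computable_map_code computable_intros)

text \<open>An element is smaller than its own power of 2, which is one of the summands.\<close>

lemma le_set_encode: "finite A \<Longrightarrow> a \<in> A \<Longrightarrow> a \<le> set_encode A"
proof -
  assume "finite A" "a \<in> A"
  then have "2 ^ a \<le> set_encode A"
    unfolding set_encode_def by (intro member_le_sum) auto
  with less_exp[of a] show ?thesis by linarith
qed

lemma enc_ts_component:
  assumes D: "finite D" "\<And>t. t \<in> D \<Longrightarrow> t \<le> N"
    and det: "\<And>t t'. t \<in> D \<Longrightarrow> t' \<in> D \<Longrightarrow> pfst t = pfst t' \<Longrightarrow>
      state_chan (psnd t) = state_chan (psnd t') \<Longrightarrow> t = t'"
    and Y: "finite Y" and O': "finite O'" "\<And>a. a \<in> O' \<Longrightarrow> a \<le> N"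
  shows "enc_ts (component D N i (Y, O')) =
    component_code (set_encode D) N i (prod_encode (set_encode Y, set_encode O'))"
proof -
  have states: "set_encode {..N} = (\<Sum>s<Suc N. 2 ^ s)"
    by (simp add: set_encode_def lessThan_Suc_atMost)
  have graph: "set_encode ((\<lambda>s. prod_encode (s, h s)) ` {..N}) = (\<Sum>s<Suc N. 2 ^ prod_encode (s, h s))"
    for h
    by (simp add: set_encode_def sum.reindex inj_on_def lessThan_Suc_atMost)
  have filter: "{t \<in> D. Q t} = {t \<in> {..<Suc N}. t \<in> D \<and> Q t}" for Q
    using D(2) by (auto simp: less_Suc_eq_le)
  have ls: "set_encode (state_chan ` psnd ` {t \<in> D. pfst t = psnd s}) = ls_code (set_encode D) N s" for s
    unfolding filter image_image ls_code_def set_encode_inverse[OF D(1)]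
  proof (rule set_encode_image)
    \<comment> \<open>Determinism of the machine enters through \<open>det\<close>: two transitions
      from one state on the same channel coincide.\<close>
    show "inj_on (\<lambda>t. state_chan (psnd t)) {t \<in> {..<Suc N}. t \<in> D \<and> pfst t = psnd s}"
      by (rule inj_onI, rule det) simp_all
  qed simp
  have chan: "set_encode ({state_chan s} \<inter> Y) = chan_label_code (set_encode Y) s" for s
    unfolding chan_label_code_def set_encode_inverse[OF Y] by (simp add: set_encode_def)
  have out: "set_encode (state_outs s \<inter> O') = out_label_code N (set_encode O') s" for s
  proof -
    have "state_outs s \<inter> O' = (\<lambda>a. a) ` {a \<in> {..<Suc N}. a \<in> state_outs s \<and> a \<in> O'}"
      using O'(2) by (auto simp: less_Suc_eq_le)
    then show ?thesis
      unfolding out_label_code_def state_outs_def set_encode_inverse[OF O'(1)]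
      by (simp only:) (rule set_encode_image; simp)
  qed
  have trans: "set_encode ((\<lambda>(s, c, s'). prod_encode (s, prod_encode (c, s'))) `
      (\<lambda>(s, t). (s, state_chan (psnd t), psnd t)) ` {(s, t) \<in> {..N} \<times> D. pfst t = psnd s}) =
      trans_code (set_encode D) N"
  proof -
    let ?g = "\<lambda>p. prod_encode (fst p, prod_encode (state_chan (psnd (snd p)), psnd (snd p)))"
    let ?P = "\<lambda>p. snd p \<in> D \<and> pfst (snd p) = psnd (fst p)"
    let ?A = "{p \<in> {..<Suc N} \<times> {..<Suc N}. ?P p}"
    have "{(s, t) \<in> {..N} \<times> D. pfst t = psnd s} = ?A"
      using D(2) by (auto simp: less_Suc_eq_le)
    then have "(\<lambda>(s, c, s'). prod_encode (s, prod_encode (c, s'))) `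
      (\<lambda>(s, t). (s, state_chan (psnd t), psnd t)) ` {(s, t) \<in> {..N} \<times> D. pfst t = psnd s} = ?g ` ?A"
      unfolding image_image by (intro image_cong) (simp_all add: case_prod_unfold)
    \<comment> \<open>The triple shows \<open>s\<close> and \<open>psnd t\<close>, and
      \<open>pfst t\<close> equals \<open>psnd s\<close>, so \<open>t\<close> can be recovered from
      it.\<close>
    moreover have "inj_on ?g ?A"
    proof (rule inj_onI)
      fix p p' assume p: "p \<in> ?A" "p' \<in> ?A" and eq: "?g p = ?g p'"
      have "fst p = fst p'" "psnd (snd p) = psnd (snd p')"
        using eq by simp_all
      moreover from this have "pfst (snd p) = pfst (snd p')"
        using p by simp
      ultimately show "p = p'"
        by (metis prod_decode_inverse prod_eq_iff)
    qed
    then have "set_encode (?g ` ?A) = (\<Sum>p\<in>{..<Suc N} \<times> {..<Suc N}. if ?P p then 2 ^ ?g p else 0)"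
      by (intro set_encode_image) auto
    moreover have "\<dots> = trans_code (set_encode D) N"
      unfolding trans_code_def set_encode_inverse[OF D(1)] sum.cartesian_product
      by (intro sum.cong) (simp_all add: case_prod_unfold)
    ultimately show ?thesis by (simp only:)
  qed
  show ?thesis
    unfolding enc_ts_def component_simps component_code_def states graph fst_conv snd_conv
      ls chan out trans prod_encode_inverse ..
qed

text \<open>The two inequalities are the assumptions on \<open>N\<close> under which the components
  were analysed, here with the code of the instance as \<open>N\<close>.\<close>

lemma solution_code_enc_problem:
  assumes P: "teamwork_instance (M, P)"
  shows "solution_code (enc_problem (M, P)) = enc_ts_list
    (map (component (enc_mtrans ` m_trans M) (enc_problem (M, P)) (enc_state (m_init M))) P)"
    and "enc_state (m_init M) \<le> enc_problem (M, P)"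
    and "\<And>t. t \<in> m_trans M \<Longrightarrow> enc_mtrans t \<le> enc_problem (M, P)"
proof -
  let ?x = "enc_problem (M, P)" and ?D = "enc_mtrans ` m_trans M"
  have M: "is_mealy M" "finite_mealy M"
    using P by (simp_all add: teamwork_instance_def)
  have D: "finite ?D"
    using finite_mealy_trans(1)[OF M] by simp
  have x: "?x = prod_encode (enc_mealy M,
      list_encode (map (\<lambda>(Yk, Ok). prod_encode (set_encode Yk, set_encode Ok)) P))"
    by (simp add: enc_problem_def)
  have le: "enc_mealy M \<le> ?x"
    unfolding x by (rule le_prod_encode_1)
  have init: "prod_encode (enc_letter (fst (m_init M)), snd (m_init M)) = enc_state (m_init M)"
    by (simp add: enc_state_def split: prod.splits)
  have init_le': "enc_state (m_init M) \<le> enc_mealy M" and trans_le': "set_encode ?D \<le> enc_mealy M"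
    and outs: "set_encode (m_outputs M) \<le> enc_mealy M"
    unfolding enc_mealy_def init by (rule list_encode_ge(2); simp)+
  show init_le: "enc_state (m_init M) \<le> ?x"
    using init_le' le by simp
  show trans_le: "enc_mtrans t \<le> ?x" if "t \<in> m_trans M" for t
    using trans_le' le le_set_encode[OF D, of "enc_mtrans t"] that by simp
  have "hd_code (drop_code (enc_mealy M) 4) = set_encode ?D"
    and "hd_code (drop_code (enc_mealy M) 3) = enc_state (m_init M)"
    unfolding enc_mealy_def init drop_code_list_encode
    by (simp_all add: hd_code_list_encode del: list_encode.simps)
  then have "solution_code ?x = list_encode (map (\<lambda>b. component_code (set_encode ?D) ?x
      (enc_state (m_init M)) (prod_encode (set_encode (fst b), set_encode (snd b)))) P)"
    unfolding solution_code_def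
    by (simp add: x map_code_list_encode comp_def case_prod_unfold)
  also have "\<dots> = list_encode (map (\<lambda>b. enc_ts (component ?D ?x (enc_state (m_init M)) b)) P)"
  proof (intro arg_cong[where f = list_encode] map_cong refl)
    fix b assume b: "b \<in> set P"
    then obtain k where "k < length P" "b = P ! k" by (metis in_set_conv_nth)
    then have sub: "fst b \<subseteq> m_inputs M" "snd b \<subseteq> m_outputs M"
      using P by (auto simp: teamwork_instance_def)
    have fin: "finite (m_inputs M)" "finite (m_outputs M)"
      using M(2) by (auto simp: finite_mealy_def)
    have "enc_ts (component ?D ?x (enc_state (m_init M)) (fst b, snd b)) = component_code (set_encode ?D) ?x
      (enc_state (m_init M)) (prod_encode (set_encode (fst b), set_encode (snd b)))"
    proof (rule enc_ts_component[OF D])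
      show "t \<le> ?x" if "t \<in> ?D" for t
        using that trans_le by blast
      show "t = t'" if t: "t \<in> ?D" "t' \<in> ?D" and eq: "pfst t = pfst t'"
        "state_chan (psnd t) = state_chan (psnd t')" for t t'
      proof -
        obtain q l r q' l' r' where u: "(q, l, r) \<in> m_trans M" "t = enc_mtrans (q, l, r)"
          and u': "(q', l', r') \<in> m_trans M" "t' = enc_mtrans (q', l', r')"
          using t by force
        then have "q = q'" "fst l = fst l'"
          using eq by (simp_all add: enc_mtrans_eq)
        then show ?thesis
          using mtrans_deterministic[OF M init_le trans_le] u u' by blast
      qed
      show "finite (fst b)" "finite (snd b)"
        using sub fin finite_subset by blast+
      show "a \<le> ?x" if "a \<in> snd b" for a
        using le_set_encode[OF fin(2), of a] that sub(2) outs le by force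
    qed
    then show "component_code (set_encode ?D) ?x (enc_state (m_init M))
        (prod_encode (set_encode (fst b), set_encode (snd b))) =
      enc_ts (component ?D ?x (enc_state (m_init M)) b)"
      by simp
  qed
  also have "\<dots> = enc_ts_list (map (component ?D ?x (enc_state (m_init M))) P)"
    by (simp add: enc_ts_list_def comp_def)
  finally show "solution_code ?x = \<dots>" .
qed

theorem mainTheorem2:
  shows "\<exists>f. computable f \<and>
    (\<forall>P. teamwork_instance P \<longrightarrow>
      (if \<exists>Ts. teamwork_solution P Ts
       then \<exists>Ts. teamwork_solution P Ts \<and> (\<forall>T \<in> set Ts. finite_ts T) \<and>
              f (enc_problem P) = Suc (enc_ts_list Ts)
       else f (enc_problem P) = 0))"
proof (intro exI[of _ "\<lambda>x. Suc (solution_code x)"] conjI allI impI)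
  show "computable (\<lambda>x. Suc (solution_code x))"
    by (rule computable_comp[OF computable_Suc computable_solution_code])
  fix MP assume inst: "teamwork_instance MP"
  obtain M P where MP: "MP = (M, P)" by fastforce
  have M: "is_mealy M" "finite_mealy M"
    using inst by (simp_all add: MP teamwork_instance_def)
  let ?Ts = "map (component (enc_mtrans ` m_trans M) (enc_problem MP) (enc_state (m_init M))) P"
  \<comment> \<open>Every instance is solved, so the value 0 for unsolvability never arises; hence
    the witness is a successor throughout.\<close>
  have sol: "teamwork_solution MP ?Ts"
    unfolding MP
    by (rule components_solution[OF M solution_code_enc_problem(2,3)]) (use inst MP in simp_all)
  have "finite_ts (?Ts ! k)" if "k < length P" for k
  proof -
    have "fst (P ! k) \<subseteq> m_inputs M" "snd (P ! k) \<subseteq> m_outputs M"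
      using inst that by (auto simp: MP teamwork_instance_def)
    then show ?thesis
      using that M(2) by (auto simp: finite_ts_def finite_mealy_def dest: finite_subset)
  qed
  then have "\<forall>T\<in>set ?Ts. finite_ts T"
    by (metis in_set_conv_nth length_map)
  moreover have "solution_code (enc_problem MP) = enc_ts_list ?Ts"
    using solution_code_enc_problem(1) inst by (simp add: MP)
  ultimately have "\<exists>Ts. teamwork_solution MP Ts \<and> (\<forall>T \<in> set Ts. finite_ts T) \<and>
      Suc (solution_code (enc_problem MP)) = Suc (enc_ts_list Ts)"
    using sol by metis
  with sol show "if \<exists>Ts. teamwork_solution MP Ts
       then \<exists>Ts. teamwork_solution MP Ts \<and> (\<forall>T \<in> set Ts. finite_ts T) \<and>
              Suc (solution_code (enc_problem MP)) = Suc (enc_ts_list Ts)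
       else Suc (solution_code (enc_problem MP)) = 0"
    by metis
qed

end
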